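(* Let $G$ be a signed digraph. If $G$ is non-separating and has feedback number $2$, then $H_2$ is embedded in $G$.
   Context: A signed digraph $G=(V,E)$ has finite vertex set $V$ and arcs $E\subseteq V\times V\times\{-1,1\}$ ($(j,i,s)$: arc from $j$ to $i$ of sign $s$; loops and opposite-sign parallel arcs allowed). Cycles and paths are simple subgraphs; sign = product of arc signs. The feedback number of $G$ is the minimum size of a set $I\subseteq V$ such that $G\setminus I$ has no cycle. A BN on $V$ is $f:\{0,1\}^V\to\{0,1\}^V$; $G(f)$ has a positive (negative) arc from $j$ to $i$ iff for some $x$ with $x_j=0$, $f_i(x+e_j)-f_i(x)$ is positive (negative) ($e_j$ = configuration equal to $1$ only at $j$, $+$ mod 2). $F(G)=\{f:G(f)=G\}$. $\Gamma(f)$ is the digraph on $\{0,1\}^V$ with arcs $x\to x+e_i$ whenever $f_i(x)\neq x_i$; attractors are inclusion-minimal nonempty sets with no outgoing arc. A subspace is $\{x:x_i=c(i)\ \forall i\in I\}$; $[X]$ is the smallest subspace containing $X$. $G$ is separating if for all $f\in F(G)$ and distinct attractors $A,B$ of $\Gamma(f)$, $[A]\cap[B]=\emptyset$; non-separating otherwise. $H_2$ is the signed digraph with vertex set $\{1,2\}$ whose arcs are: a positive and a negative loop on $1$, a positive loop on $2$, a positive and a negative arc from $1$ to $2$, and a positive and a negative arc from $2$ to $1$ (no negative loop on $2$). A signed digraph $H$ with vertex set $U$ is embedded in $G$ if there is an injection $\phi:U\to V$ such that for every positive (negative) arc of $H$ from $j$ to $i$, $G$ contains a positive (negative) path from $\phi(j)$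 to $\phi(i)$ whose internal vertices are not in $\phi(U)$; for a loop on $j$ this means a positive (negative) cycle of $G$ through $\phi(j)$ whose other vertices are not in $\phi(U)$. *)

theory Defs
  imports Complex_Main "HOL-Library.FuncSet" "Graph_Theory.Graph_Theory"
begin

section \<open>Signed digraphs\<close>

record 'v signed_graph =
  vertices :: "'v set"
  sarcs :: "('v \<times> 'v \<times> int) set"

definition signed_digraph :: "'v signed_graph \<Rightarrow> bool" where
  "signed_digraph G \<longleftrightarrow>
     finite (vertices G) \<and> sarcs G \<subseteq> vertices G \<times> vertices G \<times> {-1, 1}"

text \<open>The underlying multi-digraph; the signed arc itself serves as the arc identity, so that
  parallel arcs of opposite sign remain distinct arcs.\<close>

definition digraph_of :: "'v signed_graph \<Rightarrow> ('v, 'v \<times> 'v \<times> int) pre_digraph" where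
  "digraph_of G = \<lparr> verts = vertices G, arcs = sarcs G, tail = fst, head = fst \<circ> snd \<rparr>"

definition walk_sign :: "('v \<times> 'v \<times> int) list \<Rightarrow> int" where
  "walk_sign p = prod_list (map (snd \<circ> snd) p)"

definition feedback_vertex_set :: "'v signed_graph \<Rightarrow> 'v set \<Rightarrow> bool" where
  "feedback_vertex_set G I \<longleftrightarrow>
     I \<subseteq> vertices G \<and> (\<nexists>p. pre_digraph.cycle (digraph_of G \<restriction> (vertices G - I)) p)"

definition feedback_number :: "'v signed_graph \<Rightarrow> nat" where
  "feedback_number G = (LEAST k. \<exists>I. feedback_vertex_set G I \<and> card I = k)"


section \<open>Boolean networks\<close>

definition configs :: "'v set \<Rightarrow> ('v \<Rightarrow> int) set" where
  "configs V = V \<rightarrow>\<^sub>E {0, 1}"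

text \<open>The configuration $x + e_i$, with addition modulo 2.\<close>

definition flip :: "('v \<Rightarrow> int) \<Rightarrow> 'v \<Rightarrow> ('v \<Rightarrow> int)" where
  "flip x i = x(i := (x i + 1) mod 2)"

definition boolean_networks :: "'v set \<Rightarrow> (('v \<Rightarrow> int) \<Rightarrow> ('v \<Rightarrow> int)) set" where
  "boolean_networks V = configs V \<rightarrow>\<^sub>E configs V"

definition interaction_graph ::
    "'v set \<Rightarrow> (('v \<Rightarrow> int) \<Rightarrow> ('v \<Rightarrow> int)) \<Rightarrow> 'v signed_graph" where
  "interaction_graph V f =
     \<lparr> vertices = V,
       sarcs = {(j, i, 1) | j i. j \<in> V \<and> i \<in> V \<and>
                  (\<exists>x \<in> configs V. x j = 0 \<and> f (flip x j) i - f x i > 0)}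
             \<union> {(j, i, -1) | j i. j \<in> V \<and> i \<in> V \<and>
                  (\<exists>x \<in> configs V. x j = 0 \<and> f (flip x j) i - f x i < 0)} \<rparr>"

definition networks_on :: "'v signed_graph \<Rightarrow> (('v \<Rightarrow> int) \<Rightarrow> ('v \<Rightarrow> int)) set" where
  "networks_on G =
     {f \<in> boolean_networks (vertices G). interaction_graph (vertices G) f = G}"

definition async_arcs ::
    "'v set \<Rightarrow> (('v \<Rightarrow> int) \<Rightarrow> ('v \<Rightarrow> int)) \<Rightarrow> (('v \<Rightarrow> int) \<times> ('v \<Rightarrow> int)) set" where
  "async_arcs V f = {(x, flip x i) | x i. x \<in> configs V \<and> i \<in> V \<and> f x i \<noteq> x i}"

definition trap_set ::
    "'v set \<Rightarrow> (('v \<Rightarrow> int) \<Rightarrow> ('v \<Rightarrow> int)) \<Rightarrow> ('v \<Rightarrow> int) set \<Rightarrow> bool" where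
  "trap_set V f A \<longleftrightarrow> A \<subseteq> configs V \<and> (\<forall>(x, y) \<in> async_arcs V f. x \<in> A \<longrightarrow> y \<in> A)"

definition attractor ::
    "'v set \<Rightarrow> (('v \<Rightarrow> int) \<Rightarrow> ('v \<Rightarrow> int)) \<Rightarrow> ('v \<Rightarrow> int) set \<Rightarrow> bool" where
  "attractor V f A \<longleftrightarrow>
     A \<noteq> {} \<and> trap_set V f A \<and> (\<forall>B. B \<noteq> {} \<and> trap_set V f B \<and> B \<subseteq> A \<longrightarrow> B = A)"

definition is_subspace :: "'v set \<Rightarrow> ('v \<Rightarrow> int) set \<Rightarrow> bool" where
  "is_subspace V S \<longleftrightarrow>
     (\<exists>I c. I \<subseteq> V \<and> c \<in> I \<rightarrow> {0, 1} \<and> S = {x \<in> configs V. \<forall>i \<in> I. x i = c i})"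

definition subspace_hull :: "'v set \<Rightarrow> ('v \<Rightarrow> int) set \<Rightarrow> ('v \<Rightarrow> int) set" where
  "subspace_hull V X = is_subspace V hull X"

text \<open>Subspaces are nonempty, hence not closed under arbitrary intersection; for nonempty \<open>X\<close>
  the hull is nevertheless the smallest subspace containing \<open>X\<close>.\<close>

lemma is_subspace_subspace_hull:
  assumes "X \<noteq> {}" "X \<subseteq> configs V"
  shows "is_subspace V (subspace_hull V X)"
proof -
  obtain a where a: "a \<in> X" using assms(1) by blast
  define I where "I = {i \<in> V. \<forall>y \<in> X. y i = a i}"
  define S where "S = {x \<in> configs V. \<forall>i \<in> I. x i = a i}"
  have "a \<in> I \<rightarrow> {0, 1}"
  proof
    fix i assume "i \<in> I"
    then have "i \<in> V" by (simp add: I_def)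
    moreover have "a \<in> V \<rightarrow>\<^sub>E {0, 1}" using a assms(2) unfolding configs_def by blast
    ultimately show "a i \<in> {0, 1}" by (rule PiE_mem[rotated])
  qed
  moreover have "I \<subseteq> V" unfolding I_def by blast
  ultimately have S: "is_subspace V S"
    unfolding is_subspace_def S_def by (intro exI[of _ I] exI[of _ a] conjI refl)
  have "is_subspace V hull X = S"
  proof (rule hull_unique)
    show "X \<subseteq> S" using assms(2) unfolding S_def I_def by blast
    show "is_subspace V S" by (rule S)
  next
    fix T assume XT: "X \<subseteq> T" and "is_subspace V T"
    then obtain J c where J: "J \<subseteq> V" "T = {x \<in> configs V. \<forall>i \<in> J. x i = c i}"
      unfolding is_subspace_def by blast
    have Xc: "y i = c i" if "y \<in> X" "i \<in> J" for y i using that XT J(2) by blast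
    have Ji: "i \<in> I" if "i \<in> J" for i
    proof -
      have "i \<in> V" using that J(1) by blast
      moreover have "\<forall>y \<in> X. y i = a i"
      proof
        fix y assume "y \<in> X"
        then show "y i = a i" by (rule Xc[OF _ that, THEN trans]) (rule Xc[OF a that, symmetric])
      qed
      ultimately show ?thesis unfolding I_def by (intro CollectI conjI)
    qed
    show "S \<subseteq> T"
    proof
      fix x assume x: "x \<in> S"
      have "x i = c i" if "i \<in> J" for i
      proof -
        have "x i = a i" using x Ji[OF that] unfolding S_def by blast
        then show ?thesis by (rule trans) (rule Xc[OF a that])
      qed
      with x show "x \<in> T" unfolding S_def J(2) by blast
    qed
  qed
  with S show ?thesis by (simp add: subspace_hull_def)
qed

definition separating :: "'v signed_graph \<Rightarrow> bool" where
  "separating G \<longleftrightarrow>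
     (\<forall>f \<in> networks_on G. \<forall>A B.
        attractor (vertices G) f A \<and> attractor (vertices G) f B \<and> A \<noteq> B \<longrightarrow>
        subspace_hull (vertices G) A \<inter> subspace_hull (vertices G) B = {})"


section \<open>Embeddings\<close>

text \<open>The vertices of a cycle are the tails of its arcs, so the last two conjuncts of
  \<open>linking_cycle\<close> say that \<open>p\<close> passes through \<open>u\<close> and otherwise avoids \<open>W\<close>. Note that
  \<open>apath u p v\<close> with \<open>u \<noteq> v\<close> forces \<open>p\<close> to be nonempty.\<close>

definition linking_path ::
    "'v signed_graph \<Rightarrow> 'v set \<Rightarrow> 'v \<Rightarrow> ('v \<times> 'v \<times> int) list \<Rightarrow> 'v \<Rightarrow> bool" where
  "linking_path G W u p v \<longleftrightarrow>
     pre_digraph.apath (digraph_of G) u p v \<and>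
     (set (pre_digraph.awalk_verts (digraph_of G) u p) - {u, v}) \<inter> W = {}"

definition linking_cycle ::
    "'v signed_graph \<Rightarrow> 'v set \<Rightarrow> 'v \<Rightarrow> ('v \<times> 'v \<times> int) list \<Rightarrow> bool" where
  "linking_cycle G W u p \<longleftrightarrow>
     pre_digraph.cycle (digraph_of G) p \<and>
     u \<in> fst ` set p \<and> (fst ` set p - {u}) \<inter> W = {}"

definition embedded :: "'u signed_graph \<Rightarrow> 'v signed_graph \<Rightarrow> bool" where
  "embedded H G \<longleftrightarrow>
     (\<exists>\<phi>. inj_on \<phi> (vertices H) \<and> \<phi> ` vertices H \<subseteq> vertices G \<and>
        (\<forall>(j, i, s) \<in> sarcs H.
           if j = i
           then \<exists>p. linking_cycle G (\<phi> ` vertices H) (\<phi> j) p \<and> walk_sign p = s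
           else \<exists>p. linking_path G (\<phi> ` vertices H) (\<phi> j) p (\<phi> i) \<and> walk_sign p = s))"

definition H2 :: "nat signed_graph" where
  "H2 = \<lparr> vertices = {1, 2},
          sarcs = {(1, 1, 1), (1, 1, -1), (2, 2, 1),
                   (1, 2, 1), (1, 2, -1), (2, 1, 1), (2, 1, -1)} \<rparr>"

end

theory Submission
  imports Defs
begin

text \<open>Let \<open>I = {a, b}\<close> be a feedback vertex set. As \<open>G\<close> minus \<open>I\<close> is acyclic, every configuration
  can be driven, without updating \<open>a\<close> and \<open>b\<close>, to the unique configuration with the same values on
  \<open>I\<close> that is stable outside \<open>I\<close>. Hence distinct attractors have disjoint projections on \<open>{a, b}\<close>,
  and if their hulls meet, then one of them projects to a single point \<open>(\<alpha>, \<beta>)\<close> and the other one,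
  \<open>B\<close>, to the three other points. Whenever two configurations stable outside \<open>I\<close> differ on \<open>I\<close>
  only in \<open>j\<close> and have distinct images in \<open>i \<in> I\<close>, the perturbation of \<open>j\<close> has propagated to \<open>i\<close>
  along a path avoiding \<open>I\<close>, whose sign is dictated by the two changes. Comparing the stable
  configurations over the four points gives, up to exchanging \<open>a\<close> and \<open>b\<close>, all arcs of \<open>H2\<close> except
  one of the signs in each direction between \<open>a\<close> and \<open>b\<close>. For these, observe that \<open>B\<close> must at some time leave \<open>(\<not>\<alpha>, \<not>\<beta>)\<close> in either direction,
  and that up to the first such moment only one element of \<open>I\<close> has been updated.\<close>

section \<open>Boolean configurations and the signed arcs of the interaction graph\<close>

lemma configs_values: "x \<in> configs V \<Longrightarrow> k \<in> V \<Longrightarrow> x k = 0 \<or> x k = 1"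
  unfolding configs_def by (auto dest: PiE_mem)

lemma configs_eqI:
  assumes "x \<in> configs V" "y \<in> configs V" "\<And>k. k \<in> V \<Longrightarrow> x k = y k"
  shows "x = y"
  using assms unfolding configs_def by (rule PiE_ext)

lemma flip_in_configs: "x \<in> configs V \<Longrightarrow> k \<in> V \<Longrightarrow> flip x k \<in> configs V"
  unfolding configs_def flip_def by (auto simp: PiE_iff extensional_def)

lemma flip_other [simp]: "i \<noteq> k \<Longrightarrow> flip x k i = x i"
  by (simp add: flip_def)

lemma flip_same: "x \<in> configs V \<Longrightarrow> k \<in> V \<Longrightarrow> flip x k k = 1 - x k"
  using configs_values[of x V k] by (auto simp: flip_def)

lemma flip_flip: "x \<in> configs V \<Longrightarrow> k \<in> V \<Longrightarrow> flip (flip x k) k = x"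
  using configs_values[of x V k] by (auto simp: flip_def)

lemma networks_on_configs:
  "f \<in> networks_on G \<Longrightarrow> x \<in> configs (vertices G) \<Longrightarrow> f x \<in> configs (vertices G)"
  unfolding networks_on_def boolean_networks_def by (auto dest: PiE_mem)

lemma networks_on_sarcs:
  assumes f: "f \<in> networks_on G" and "x \<in> configs (vertices G)"
    and "j \<in> vertices G" "i \<in> vertices G" "x j = 0" "f (flip x j) i \<noteq> f x i"
  shows "(j, i, f (flip x j) i - f x i) \<in> sarcs G"
proof -
  let ?V = "vertices G"
  have G: "sarcs G = sarcs (interaction_graph ?V f)"
    using f by (simp add: networks_on_def)
  have "f x i = 0 \<or> f x i = 1" "f (flip x j) i = 0 \<or> f (flip x j) i = 1"
    using configs_values[OF networks_on_configs[OF f assms(2)] assms(4)]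
      configs_values[OF networks_on_configs[OF f flip_in_configs[OF assms(2,3)]] assms(4)]
    by simp_all
  then consider "f (flip x j) i - f x i = 1" | "f (flip x j) i - f x i = -1"
    using assms(6) by fastforce
  then show ?thesis
  proof cases
    case 1
    then show ?thesis unfolding G interaction_graph_def using assms(2-5) by force
  next
    case 2
    then show ?thesis unfolding G interaction_graph_def using assms(2-5) by force
  qed
qed

text \<open>If \<open>x j = 1\<close>, then the definition of the arcs applies to
  \<open>flip x j\<close> instead. Exchanging the two configurations negates both factors, so their
  product is the sign of the arc in either case.\<close>

lemma networks_on_flip:
  assumes f: "f \<in> networks_on G" and x: "x \<in> configs (vertices G)"
    and j: "j \<in> vertices G" and i: "i \<in> vertices G" and neq: "f (flip x j) i \<noteq> f x i"
  shows "(j, i, (f (flip x j) i - f x i) * (flip x j j - x j)) \<in> sarcs G"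
proof (cases "x j = 0")
  case True
  then show ?thesis using networks_on_sarcs[OF f x j i True neq] flip_same[OF x j] by simp
next
  case False
  let ?y = "flip x j"
  have xj: "x j = 1" using configs_values[OF x j] False by simp
  have "(j, i, f (flip ?y j) i - f ?y i) \<in> sarcs G"
    using neq xj by (intro networks_on_sarcs f flip_in_configs x j i)
      (auto simp: flip_flip[OF x j] flip_same[OF x j])
  then show ?thesis by (simp add: flip_flip[OF x j] flip_same[OF x j] xj)
qed

text \<open>Turn \<open>x\<close> into \<open>y\<close> one coordinate at a time. The image at
  \<open>i\<close> changes at some step, and since it is binary its first change already brings it
  to \<open>f y i\<close>; the coordinate flipped at that step is \<open>k\<close>.\<close>

lemma networks_on_differ:
  assumes f: "f \<in> networks_on G" and G: "signed_digraph G"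
    and "x \<in> configs (vertices G)" and y: "y \<in> configs (vertices G)"
    and i: "i \<in> vertices G" and "f y i \<noteq> f x i"
  shows "\<exists>k \<in> vertices G. y k \<noteq> x k \<and> (k, i, (f y i - f x i) * (y k - x k)) \<in> sarcs G"
  using assms(3,6)
proof (induction "card {k \<in> vertices G. y k \<noteq> x k}" arbitrary: x rule: less_induct)
  case less
  let ?V = "vertices G"
  have "y \<noteq> x" using less.prems(2) by auto
  then obtain k where k: "k \<in> ?V" "y k \<noteq> x k"
    using configs_eqI[OF y less.prems(1)] by blast
  let ?z = "flip x k"
  have z: "?z \<in> configs ?V" using less.prems(1) k(1) by (rule flip_in_configs)
  have zk: "?z k = y k"
    using flip_same[OF less.prems(1) k(1)] k configs_values[OF y k(1)]
      configs_values[OF less.prems(1) k(1)] by auto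
  show ?case
  proof (cases "f ?z i = f x i")
    case True
    have "finite ?V" using G by (simp add: signed_digraph_def)
    moreover have "{l \<in> ?V. y l \<noteq> ?z l} \<subset> {l \<in> ?V. y l \<noteq> x l}"
    proof
      show "{l \<in> ?V. y l \<noteq> ?z l} \<subseteq> {l \<in> ?V. y l \<noteq> x l}"
        using k by (auto, metis flip_other)
      have "k \<in> {l \<in> ?V. y l \<noteq> x l}" "k \<notin> {l \<in> ?V. y l \<noteq> ?z l}"
        using k zk by simp_all
      then show "{l \<in> ?V. y l \<noteq> ?z l} \<noteq> {l \<in> ?V. y l \<noteq> x l}" by metis
    qed
    ultimately have "card {l \<in> ?V. y l \<noteq> ?z l} < card {l \<in> ?V. y l \<noteq> x l}"
      by (intro psubset_card_mono) auto
    from less.hyps[OF this z] less.prems(2) True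
    obtain l where l: "l \<in> ?V" "y l \<noteq> ?z l" "(l, i, (f y i - f x i) * (y l - ?z l)) \<in> sarcs G"
      by auto
    then have "l \<noteq> k" using zk by auto
    with l show ?thesis by auto
  next
    case False
    have "f w i = 0 \<or> f w i = 1" if "w \<in> configs ?V" for w
      using configs_values[OF networks_on_configs[OF f that] i] .
    from this[OF z] this[OF y] this[OF less.prems(1)] False less.prems(2)
    have "f ?z i = f y i" by auto
    then show ?thesis
      using networks_on_flip[OF f less.prems(1) k(1) i False] k zk by auto
  qed
qed

section \<open>Trap sets, attractors and hulls\<close>

lemma trap_set_flip:
  assumes "trap_set V f A" "x \<in> A" "i \<in> V" "f x i \<noteq> x i"
  shows "flip x i \<in> A"
  using assms unfolding trap_set_def async_arcs_def by blast

lemma attractor_minimal: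
  assumes "attractor V f A" "trap_set V f B" "B \<noteq> {}" "B \<subseteq> A"
  shows "B = A"
  using assms by (simp add: attractor_def)

lemma attractors_disjoint:
  assumes "attractor V f A" "attractor V f B" "A \<noteq> B"
  shows "A \<inter> B = {}"
proof (rule ccontr)
  assume ne: "A \<inter> B \<noteq> {}"
  have "trap_set V f (A \<inter> B)"
    using assms(1,2) unfolding attractor_def trap_set_def by fastforce
  then have "A \<inter> B = A" "A \<inter> B = B"
    using attractor_minimal[OF assms(1) _ ne] attractor_minimal[OF assms(2) _ ne] by blast+
  with assms(3) show False by auto
qed

lemma attractor_fixed_point:
  assumes A: "attractor V f A" and x: "x \<in> A" and fixed: "\<And>i. i \<in> V \<Longrightarrow> f x i = x i"
  shows "A = {x}"
proof -
  have "x \<in> configs V" using A x by (auto simp: attractor_def trap_set_def)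
  then have "trap_set V f {x}" using fixed unfolding trap_set_def async_arcs_def by auto
  then show ?thesis using attractor_minimal[OF A, of "{x}"] x by simp
qed

text \<open>A common point \<open>z\<close> of the hulls serves both sides: a set that avoids the
  value \<open>z i\<close> at \<open>i\<close> lies in the half cube with the other value, and so
  does its hull, which then misses \<open>z\<close>.\<close>

lemma hulls_meet_coordinate:
  assumes A: "A \<noteq> {}" "A \<subseteq> configs V" and B: "B \<noteq> {}" "B \<subseteq> configs V"
    and meet: "subspace_hull V A \<inter> subspace_hull V B \<noteq> {}" and i: "i \<in> V"
  shows "\<exists>x \<in> A. \<exists>y \<in> B. x i = y i"
proof -
  obtain z where z: "z \<in> subspace_hull V A" "z \<in> subspace_hull V B" using meet by blast
  have *: "\<exists>x \<in> C. x i = z i" if C: "C \<noteq> {}" "C \<subseteq> configs V" and zC: "z \<in> subspace_hull V C" for C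
  proof (rule ccontr)
    assume no: "\<not> (\<exists>x \<in> C. x i = z i)"
    obtain c where c: "c \<in> C" using C by blast
    let ?S = "{x \<in> configs V. \<forall>l \<in> {i}. x l = c l}"
    have ci: "c i \<in> {0, 1}" using configs_values[OF subsetD[OF C(2) c] i] by simp
    have S: "is_subspace V ?S"
      unfolding is_subspace_def using i ci by (intro exI[of _ "{i}"] exI[of _ c]) auto
    have "z \<in> configs V"
    proof -
      have "is_subspace V (configs V)"
        unfolding is_subspace_def by (intro exI[of _ "{}"]) auto
      then show ?thesis using zC C unfolding subspace_hull_def hull_def by blast
    qed
    then have zi: "z i = 0 \<or> z i = 1" using i by (rule configs_values)
    have "C \<subseteq> ?S"
    proof
      fix x assume x: "x \<in> C"
      have "x i = 0 \<or> x i = 1" using configs_values[OF subsetD[OF C(2) x] i] .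
      then have "x i = c i" using zi no x c ci by force
      then show "x \<in> ?S" using x C by auto
    qed
    then have "z \<in> ?S" using zC S unfolding subspace_hull_def hull_def by blast
    then show False using no c by auto
  qed
  from *[OF A z(1)] *[OF B z(2)] show ?thesis by metis
qed

section \<open>Walks, signs and feedback vertex sets\<close>

lemma wf_digraph_of:
  assumes "signed_digraph G"
  shows "wf_digraph (digraph_of G)"
  using assms by unfold_locales (auto simp: digraph_of_def signed_digraph_def)

lemma digraph_of_simps [simp]:
  "verts (digraph_of G) = vertices G" "arcs (digraph_of G) = sarcs G"
  "tail (digraph_of G) = fst" "head (digraph_of G) = fst \<circ> snd"
  by (simp_all add: digraph_of_def)

lemma walk_sign_simps [simp]:
  "walk_sign [] = 1" "walk_sign (p @ q) = walk_sign p * walk_sign q" "walk_sign [(j, i, s)] = s"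
  by (simp_all add: walk_sign_def)

text \<open>The minimum is attained because the set of all vertices is a feedback vertex set: no
  vertex is left to carry a cycle.\<close>

lemma feedback_number_witness:
  assumes "signed_digraph G"
  shows "\<exists>I. feedback_vertex_set G I \<and> card I = feedback_number G"
proof -
  have "feedback_vertex_set G (vertices G)"
    unfolding feedback_vertex_set_def pre_digraph.cycle_def pre_digraph.awalk_def by simp
  then show ?thesis unfolding feedback_number_def
    by (intro LeastI[of "\<lambda>k. \<exists>I. feedback_vertex_set G I \<and> card I = k" "card (vertices G)"]) blast
qed

section \<open>The acyclic part outside the feedback vertex set\<close>

locale feedback_network =
  fixes G :: "'v signed_graph" and f :: "('v \<Rightarrow> int) \<Rightarrow> ('v \<Rightarrow> int)" and I :: "'v set"
  assumes signed: "signed_digraph G" and network: "f \<in> networks_on G"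
    and feedback: "feedback_vertex_set G I"
begin

abbreviation V :: "'v set" where "V \<equiv> vertices G"

abbreviation U :: "'v set" where "U \<equiv> V - I"

sublocale D: wf_digraph "digraph_of G"
  using signed by (rule wf_digraph_of)

text \<open>Signs are dropped to obtain a plain relation, along which well-founded induction is
  possible.\<close>

definition free_arcs :: "('v \<times> 'v) set" where
  "free_arcs = {(j, k). j \<in> U \<and> k \<in> U \<and> (\<exists>s. (j, k, s) \<in> sarcs G)}"

lemma I_subset: "I \<subseteq> V"
  using feedback by (simp add: feedback_vertex_set_def)

lemma acyclic_free_arcs: "acyclic free_arcs"
proof (rule acyclicI, intro allI notI)
  fix v assume v: "(v, v) \<in> free_arcs\<^sup>+"
  interpret H: wf_digraph "digraph_of G \<restriction> U" by (rule D.wellformed_induce_subgraph)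
  have "free_arcs \<subseteq> arcs_ends (digraph_of G \<restriction> U)"
    unfolding free_arcs_def arcs_ends_def arc_to_ends_def by force
  then have "v \<rightarrow>\<^sup>+\<^bsub>digraph_of G \<restriction> U\<^esub> v" using v trancl_mono by blast
  then obtain p where "H.awalk v p v" "p \<noteq> []" using H.reachable1_awalk by blast
  then have "H.closed_w p" unfolding H.closed_w_def by auto
  then show False
    using H.closed_w_imp_cycle feedback unfolding feedback_vertex_set_def by blast
qed

lemma finite_free_arcs: "finite free_arcs"
proof -
  have "free_arcs \<subseteq> V \<times> V" unfolding free_arcs_def by blast
  then show ?thesis
    using signed finite_subset unfolding signed_digraph_def by blast
qed

lemma wf_free_arcs: "wf free_arcs"
  using finite_free_arcs acyclic_free_arcs by (rule finite_acyclic_wf)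

section \<open>Signed links with interior outside the feedback vertex set\<close>

lemma awalk_verts_heads:
  assumes "D.awalk j p k"
  shows "D.awalk_verts j p = j # map (fst \<circ> snd) p"
  using assms D.awalk_verts_conv'[of j p k] D.awalkE by (cases p) auto

text \<open>Remembering that every inner vertex reaches \<open>k\<close> in the acyclic part is what keeps such paths
  simple under extension.\<close>

definition free_link :: "'v \<Rightarrow> 'v \<Rightarrow> int \<Rightarrow> bool" where
  "free_link j k s \<longleftrightarrow> (\<exists>p. D.awalk j p k \<and> distinct (map (fst \<circ> snd) p) \<and> walk_sign p = s \<and>
     (\<forall>w \<in> set (map (fst \<circ> snd) p). w \<in> U \<and> (w, k) \<in> free_arcs\<^sup>*))"

lemma free_link_refl: "j \<in> V \<Longrightarrow> free_link j j 1"
  unfolding free_link_def by (intro exI[of _ "[]"]) (simp add: D.awalk_Nil_iff)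

lemma awalk_snoc:
  assumes "D.awalk j p k" "(k, l, t) \<in> sarcs G"
  shows "D.awalk j (p @ [(k, l, t)]) l"
proof -
  have "D.awalk k [(k, l, t)] l"
    using D.arc_implies_awalk[of "(k, l, t)"] assms(2) by simp
  then show ?thesis using assms(1) by (rule D.awalk_appendI[rotated])
qed

lemma awalk_last_head: "D.awalk j p k \<Longrightarrow> p \<noteq> [] \<Longrightarrow> k \<in> set (map (fst \<circ> snd) p)"
  by (cases p rule: rev_cases) (auto simp: D.awalk_Nil_iff D.awalk_Cons_iff)

text \<open>The new vertex \<open>l\<close> cannot occur among the earlier heads: it would reach
  \<open>k\<close> by free arcs, and the arc from \<open>k\<close> to \<open>l\<close> would close a
  cycle outside \<open>I\<close>.\<close>

lemma free_link_step:
  assumes "free_link j k s" and arc: "(k, l, t) \<in> sarcs G" and l: "l \<in> U"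
  shows "free_link j l (s * t)"
proof -
  obtain p where p: "D.awalk j p k" "distinct (map (fst \<circ> snd) p)" "walk_sign p = s"
    "\<And>w. w \<in> set (map (fst \<circ> snd) p) \<Longrightarrow> w \<in> U \<and> (w, k) \<in> free_arcs\<^sup>*"
    using assms(1) unfolding free_link_def by blast
  \<comment> \<open>The empty walk is exempt: there \<open>k\<close> is \<open>j\<close>, which may
    belong to \<open>I\<close>.\<close>
  have kl: "(k, l) \<in> free_arcs" if "p \<noteq> []"
    using p(4)[OF awalk_last_head[OF p(1) that]] arc l unfolding free_arcs_def by blast
  have "l \<notin> set (map (fst \<circ> snd) p)"
  proof
    assume l': "l \<in> set (map (fst \<circ> snd) p)"
    then have "(l, k) \<in> free_arcs\<^sup>*" "(k, l) \<in> free_arcs" using p(4) kl by force+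
    then have "(l, l) \<in> free_arcs\<^sup>+" by (rule rtrancl_into_trancl1)
    then show False using acyclic_free_arcs by (simp add: acyclic_def)
  qed
  moreover have "w \<in> U \<and> (w, l) \<in> free_arcs\<^sup>*" if "w \<in> set (map (fst \<circ> snd) p)" for w
    using p(4)[OF that] kl that by (force intro: rtrancl_into_rtrancl)
  ultimately show ?thesis
    unfolding free_link_def using awalk_snoc[OF p(1) arc] p(2,3) l
    by (intro exI[of _ "p @ [(k, l, t)]"]) auto
qed

text \<open>This is what an embedding with image \<open>I\<close> demands for a single arc of sign
  \<open>s\<close>.\<close>

definition connection :: "'v \<Rightarrow> 'v \<Rightarrow> int \<Rightarrow> bool" where
  "connection j i s \<longleftrightarrow>
     (if j = i then \<exists>p. linking_cycle G I j p \<and> walk_sign p = s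
      else \<exists>p. linking_path G I j p i \<and> walk_sign p = s)"

text \<open>All heads of the link lie in \<open>U\<close>, so a final arc into \<open>I\<close>
  repeats no head. It completes a cycle through \<open>j\<close> if \<open>i = j\<close>, and a path
  otherwise.\<close>

lemma free_link_connection:
  assumes "free_link j k s" and arc: "(k, i, t) \<in> sarcs G" and j: "j \<in> I" and i: "i \<in> I"
  shows "connection j i (s * t)"
proof -
  obtain p where p: "D.awalk j p k" "distinct (map (fst \<circ> snd) p)" "walk_sign p = s"
    "\<And>w. w \<in> set (map (fst \<circ> snd) p) \<Longrightarrow> w \<in> U \<and> (w, k) \<in> free_arcs\<^sup>*"
    using assms(1) unfolding free_link_def by blast
  define q where "q = p @ [(k, i, t)]"
  have q: "D.awalk j q i" unfolding q_def using p(1) arc by (rule awalk_snoc)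
  have verts: "D.awalk_verts j q = j # map (fst \<circ> snd) p @ [i]"
    using awalk_verts_heads[OF q] by (simp add: q_def)
  have "i \<notin> set (map (fst \<circ> snd) p)" "j \<notin> set (map (fst \<circ> snd) p)" using p(4) i j by blast+
  then have dist: "distinct (map (fst \<circ> snd) p @ [i])" "j \<noteq> i \<Longrightarrow> distinct (D.awalk_verts j q)"
    using p(2) verts by auto
  have sgn: "walk_sign q = s * t" using p(3) by (simp add: q_def)
  show ?thesis
  proof (cases "j = i")
    case True
    have tails: "map fst q = j # map (fst \<circ> snd) p"
      using D.awalk_verts_conv[of j q] verts by (auto simp: q_def)
    have "fst ` set q = set (map fst q)" by simp
    then have "fst ` set q = insert j (set (map (fst \<circ> snd) p))" unfolding tails by simp
    moreover have "D.cycle q" unfolding D.cycle_def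
      using q True verts dist(1) by (intro exI[of _ j]) (auto simp: q_def)
    ultimately have "linking_cycle G I j q" unfolding linking_cycle_def using p(4) by blast
    then show ?thesis using sgn True unfolding connection_def by auto
  next
    case False
    then have "D.apath j q i" using q dist(2) by (simp add: D.apath_def)
    then have "linking_path G I j q i" unfolding linking_path_def verts using p(4) by auto
    then show ?thesis using sgn False unfolding connection_def by auto
  qed
qed

section \<open>Propagation of a perturbation at one vertex\<close>

definition free_stable :: "('v \<Rightarrow> int) \<Rightarrow> bool" where
  "free_stable x \<longleftrightarrow> x \<in> configs V \<and> (\<forall>k \<in> U. f x k = x k)"

text \<open>The factor \<open>1 - 2 * x j\<close> is the only change that \<open>j\<close> can undergo starting from \<open>x\<close>.\<close>

definition perturbed :: "'v \<Rightarrow> ('v \<Rightarrow> int) \<Rightarrow> ('v \<Rightarrow> int) \<Rightarrow> bool" where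
  "perturbed j x v \<longleftrightarrow> v \<in> configs V \<and>
     (\<forall>k \<in> V. v k \<noteq> x k \<longrightarrow> k \<in> insert j U \<and> free_link j k ((v k - x k) * (1 - 2 * x j)))"

lemma network_configs: "x \<in> configs V \<Longrightarrow> f x \<in> configs V"
  using network by (rule networks_on_configs)

lemmas network_differ = networks_on_differ[OF network signed]

lemmas network_flip = networks_on_flip[OF network]

lemma free_link_self_change:
  assumes "x \<in> configs V" "v \<in> configs V" "j \<in> V" "v j \<noteq> x j"
  shows "free_link j j ((v j - x j) * (1 - 2 * x j))"
proof -
  have "(v j - x j) * (1 - 2 * x j) = 1"
    using configs_values[OF assms(1,3)] configs_values[OF assms(2,3)] assms(4) by auto
  then show ?thesis using free_link_refl[OF assms(3)] by simp
qed

text \<open>The change at the intermediate vertex \<open>k\<close> is 1 or -1 and enters the sign of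
  a concatenation twice, hence drops out.\<close>

lemma change_cancel:
  assumes "x \<in> configs V" "v \<in> configs V" "k \<in> V" "v k \<noteq> x k"
  shows "((v k - x k) * s) * (t * (v k - x k)) = t * s"
  using configs_values[OF assms(1,3)] configs_values[OF assms(2,3)] assms(4) by auto

text \<open>Some changed in-neighbour \<open>k\<close> accounts for the change of the image at
  \<open>i\<close>; the link from \<open>j\<close> to \<open>k\<close> is prolonged by the arc from
  \<open>k\<close> to \<open>i\<close>.\<close>

lemma perturbed_free_link:
  assumes x: "x \<in> configs V" and v: "perturbed j x v" and i: "i \<in> U" and neq: "f v i \<noteq> f x i"
  shows "free_link j i ((f v i - f x i) * (1 - 2 * x j))"
proof -
  have vc: "v \<in> configs V" using v by (simp add: perturbed_def)
  have "i \<in> V" using i by blast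
  from network_differ[OF x vc this neq]
  obtain k where k: "k \<in> V" "v k \<noteq> x k" "(k, i, (f v i - f x i) * (v k - x k)) \<in> sarcs G"
    by (elim bexE conjE)
  have "free_link j k ((v k - x k) * (1 - 2 * x j))" using v k by (simp add: perturbed_def)
  from free_link_step[OF this k(3) i] show ?thesis unfolding change_cancel[OF x vc k(1,2)] .
qed

lemma perturbed_connection:
  assumes x: "x \<in> configs V" and v: "perturbed j x v" and j: "j \<in> I" and i: "i \<in> I"
    and neq: "f v i \<noteq> f x i"
  shows "connection j i ((f v i - f x i) * (1 - 2 * x j))"
proof -
  have vc: "v \<in> configs V" using v by (simp add: perturbed_def)
  have "i \<in> V" using i I_subset by blast
  from network_differ[OF x vc this neq]
  obtain k where k: "k \<in> V" "v k \<noteq> x k" "(k, i, (f v i - f x i) * (v k - x k)) \<in> sarcs G"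
    by (elim bexE conjE)
  have "free_link j k ((v k - x k) * (1 - 2 * x j))" using v k by (simp add: perturbed_def)
  from free_link_connection[OF this k(3) j i] show ?thesis unfolding change_cancel[OF x vc k(1,2)] .
qed

lemma perturbed_fixes:
  assumes v: "perturbed j x v" and i: "i \<in> I" "i \<noteq> j"
  shows "v i = x i"
proof (rule ccontr)
  assume "v i \<noteq> x i"
  moreover have "i \<in> V" using i(1) I_subset by auto
  ultimately have "i \<in> insert j U" using v unfolding perturbed_def by simp
  then show False using i by simp
qed

lemma perturbed_refl: "x \<in> configs V \<Longrightarrow> perturbed j x x"
  by (simp add: perturbed_def)

text \<open>An update at \<open>k\<close> in \<open>U\<close> produces the value
  \<open>f v k\<close>, whereas stability gives \<open>x k = f x k\<close>. A deviation from
  \<open>x\<close> at \<open>k\<close> is therefore a difference of images, which is traced back to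
  \<open>j\<close>.\<close>

lemma perturbed_flip:
  assumes x: "free_stable x" and v: "perturbed j x v" and j: "j \<in> V"
    and k: "k \<in> insert j U" "f v k \<noteq> v k"
  shows "perturbed j x (flip v k)"
proof -
  have xc: "x \<in> configs V" using x by (simp add: free_stable_def)
  have vc: "v \<in> configs V" using v by (simp add: perturbed_def)
  have kV: "k \<in> V" using k j by blast
  have flc: "flip v k \<in> configs V" using vc kV by (rule flip_in_configs)
  have fk: "flip v k k = f v k"
    using flip_same[OF vc kV] k(2) configs_values[OF vc kV]
      configs_values[OF network_configs[OF vc] kV] by auto
  have "l \<in> insert j U \<and> free_link j l ((flip v k l - x l) * (1 - 2 * x j))"
    if l: "l \<in> V" "flip v k l \<noteq> x l" for l
  proof -
    consider "l \<noteq> k" | "l = k" "k = j" | "l = k" "k \<in> U" using k by blast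
    then show ?thesis
    proof cases
      case 1
      then show ?thesis using v l by (simp add: perturbed_def)
    next
      case 2
      then show ?thesis using free_link_self_change[OF xc flc j] l by simp
    next
      case 3
      then have "f x k = x k" using x by (simp add: free_stable_def)
      then have "free_link j k ((f v k - x k) * (1 - 2 * x j))"
        using perturbed_free_link[OF xc v 3(2)] l(2) fk 3(1) by simp
      then show ?thesis using 3 fk by simp
    qed
  qed
  then show ?thesis using flc by (simp add: perturbed_def)
qed

text \<open>No trajectory from \<open>x\<close> to \<open>y\<close> is involved. By stability, a
  difference at \<open>k\<close> in \<open>U\<close> is a difference of images, so some in-neighbour
  differs too; it is \<open>j\<close> or precedes \<open>k\<close> in the well-founded
  \<open>free_arcs\<close>.\<close>

lemma perturbed_stable:
  assumes x: "free_stable x" and y: "free_stable y" and j: "j \<in> V"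
    and eq: "\<And>i. i \<in> I \<Longrightarrow> i \<noteq> j \<Longrightarrow> y i = x i"
  shows "perturbed j x y"
proof -
  have xc: "x \<in> configs V" and yc: "y \<in> configs V" using x y by (simp_all add: free_stable_def)
  have "free_link j k ((y k - x k) * (1 - 2 * x j))" if "k \<in> V" "y k \<noteq> x k" for k
    using wf_free_arcs that
  proof (induction k rule: wf_induct_rule)
    case (less k)
    show ?case
    proof (cases "k = j")
      case True
      then show ?thesis using free_link_self_change[OF xc yc] less.prems by simp
    next
      case False
      then have kU: "k \<in> U" using eq less.prems by blast
      then have fk: "f x k = x k" "f y k = y k" using x y by (simp_all add: free_stable_def)
      then have "f y k \<noteq> f x k" using less.prems(2) by simp
      from network_differ[OF xc yc less.prems(1) this]
      obtain l where l: "l \<in> V" "y l \<noteq> x l" "(l, k, (f y k - f x k) * (y l - x l)) \<in> sarcs G"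
        by (elim bexE conjE)
      have "free_link j l ((y l - x l) * (1 - 2 * x j))"
      proof (cases "l = j")
        case True
        then show ?thesis using free_link_self_change[OF xc yc] l by simp
      next
        case False
        then have "(l, k) \<in> free_arcs" using eq l kU unfolding free_arcs_def by blast
        then show ?thesis using less.IH l by blast
      qed
      from free_link_step[OF this l(3) kU] show ?thesis
        unfolding change_cancel[OF xc yc l(1,2)] fk .
    qed
  qed
  moreover have "k \<in> insert j U" if "k \<in> V" "y k \<noteq> x k" for k
    using that eq by blast
  ultimately show ?thesis using yc unfolding perturbed_def by simp
qed

text \<open>A first vertex of difference along \<open>free_arcs\<close> would have an in-neighbour
  of difference, which can lie neither in \<open>I\<close> nor before it.\<close>

lemma free_stable_unique:
  assumes x: "free_stable x" and y: "free_stable y" and eq: "\<And>i. i \<in> I \<Longrightarrow> y i = x i"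
  shows "y = x"
proof -
  have xc: "x \<in> configs V" and yc: "y \<in> configs V" using x y by (simp_all add: free_stable_def)
  have "y k = x k" if "k \<in> V" for k
    using wf_free_arcs that
  proof (induction k rule: wf_induct_rule)
    case (less k)
    show ?case
    proof (rule ccontr)
      assume neq: "y k \<noteq> x k"
      then have kU: "k \<in> U" using eq less.prems by blast
      then have "f y k \<noteq> f x k" using x y neq by (simp add: free_stable_def)
      from network_differ[OF xc yc less.prems this]
      obtain l s where l: "l \<in> V" "y l \<noteq> x l" "(l, k, s) \<in> sarcs G"
        by (elim bexE conjE)
      then have "(l, k) \<in> free_arcs" using eq kU unfolding free_arcs_def by blast
      then show False using less.IH l by blast
    qed
  qed
  then show ?thesis using configs_eqI[OF yc xc] by blast
qed

section \<open>Stable representatives inside trap sets and attractors\<close>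

lemma network_flip_no_arc:
  assumes "x \<in> configs V" "k \<in> V" "i \<in> V" "\<And>s. (k, i, s) \<notin> sarcs G"
  shows "f (flip x k) i = f x i"
  using network_flip[OF assms(1-3)] assms(4) by blast

text \<open>The vertices of \<open>U\<close> are updated in an order compatible with
  \<open>free_arcs\<close>, so that no update destabilises an earlier vertex. In the induction,
  \<open>k\<close> is a vertex of \<open>W\<close> without arc into \<open>W\<close>, and it is
  updated last.\<close>

lemma trap_set_free_stable:
  assumes A: "trap_set V f A" and x: "x \<in> A"
  shows "\<exists>v \<in> A. free_stable v \<and> (\<forall>i \<in> I. v i = x i)"
proof -
  have "\<exists>v \<in> A. (\<forall>i \<in> I. v i = x i) \<and> (\<forall>k \<in> W. f v k = v k)"
    if "W \<subseteq> U" "\<And>j k. (j, k) \<in> free_arcs \<Longrightarrow> k \<in> W \<Longrightarrow> j \<in> W" for W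
    using that
  proof (induction "card W" arbitrary: W rule: less_induct)
    case less
    have finW: "finite W"
      using less.prems(1) signed finite_subset unfolding signed_digraph_def by blast
    show ?case
    proof (cases "W = {}")
      case True
      then show ?thesis using x by auto
    next
      case False
      have "wf (free_arcs\<inverse>)" using finite_free_arcs acyclic_free_arcs by (rule finite_acyclic_wf_converse)
      then obtain k where k: "k \<in> W" "\<And>l. (l, k) \<in> free_arcs\<inverse> \<Longrightarrow> l \<notin> W"
        using False by (rule wfE_min') (rule that)
      have "card (W - {k}) < card W" using finW k(1) by (rule card_Diff1_less)
      moreover have "W - {k} \<subseteq> U" using less.prems(1) by blast
      moreover have "j \<in> W - {k}" if "(j, l) \<in> free_arcs" "l \<in> W - {k}" for j l
        using less.prems(2)[OF that(1)] that k by blast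
      ultimately have "\<exists>v \<in> A. (\<forall>i \<in> I. v i = x i) \<and> (\<forall>l \<in> W - {k}. f v l = v l)"
        by (rule less.hyps)
      then obtain v where v: "v \<in> A" "\<forall>i \<in> I. v i = x i" "\<forall>l \<in> W - {k}. f v l = v l"
        by (elim bexE conjE)
      have vc: "v \<in> configs V" using A v(1) by (auto simp: trap_set_def)
      have kU: "k \<in> U" using k(1) less.prems(1) by blast
      show ?thesis
      proof (cases "f v k = v k")
        case True
        then show ?thesis using v by blast
      next
        case False
        \<comment> \<open>No arc leads from \<open>k\<close> into \<open>W\<close>, not even a loop
          on \<open>k\<close>.\<close>
        have "f (flip v k) l = f v l" if "l \<in> W" for l
          using that k less.prems(1) kU by (intro network_flip_no_arc vc) (auto simp: free_arcs_def)
        moreover have "flip v k k = f v k"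
          using flip_same[OF vc, of k] False kU configs_values[OF vc, of k]
            configs_values[OF network_configs[OF vc], of k] by auto
        moreover have "flip v k \<in> A" using trap_set_flip[OF A v(1) _ False] kU by simp
        moreover have "flip v k i = x i" if "i \<in> I" for i
          using that v(2) kU by (subst flip_other) auto
        moreover have "flip v k l = f v l" if "l \<in> W" "l \<noteq> k" for l
          using that v(3) by (subst flip_other) auto
        ultimately show ?thesis by metis
      qed
    qed
  qed
  from this[of U] obtain v where "v \<in> A" "\<forall>i \<in> I. v i = x i" "\<forall>k \<in> U. f v k = v k"
    unfolding free_arcs_def by blast
  moreover have "v \<in> configs V" using A \<open>v \<in> A\<close> by (auto simp: trap_set_def)
  ultimately show ?thesis unfolding free_stable_def by blast
qed

text \<open>Otherwise both attractors would contain the same stable configuration, although they are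
  disjoint.\<close>

lemma attractors_differ_on_feedback:
  assumes "attractor V f A" "attractor V f B" "A \<noteq> B" "x \<in> A" "y \<in> B"
  shows "\<exists>i \<in> I. x i \<noteq> y i"
proof (rule ccontr)
  assume *: "\<not> (\<exists>i \<in> I. x i \<noteq> y i)"
  have trap: "trap_set V f A" "trap_set V f B" using assms(1,2) by (simp_all add: attractor_def)
  obtain v where v: "v \<in> A" "free_stable v" "\<forall>i \<in> I. v i = x i"
    using trap_set_free_stable[OF trap(1) assms(4)] by (elim bexE conjE)
  obtain w where w: "w \<in> B" "free_stable w" "\<forall>i \<in> I. w i = y i"
    using trap_set_free_stable[OF trap(2) assms(5)] by (elim bexE conjE)
  have "w = v" using v w * by (intro free_stable_unique) auto
  then show False using attractors_disjoint[OF assms(1-3)] v w by blast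
qed

text \<open>Configurations of \<open>B\<close> reached by updating only \<open>j\<close> and vertices outside \<open>I\<close> would form a
  smaller trap set if they never required an update of another element of \<open>I\<close>.\<close>

lemma attractor_leaves_perturbed:
  assumes B: "attractor V f B" and x: "x \<in> B" "free_stable x" and j: "j \<in> V"
    and y: "y \<in> B" "i \<in> I" "i \<noteq> j" "y i \<noteq> x i"
  shows "\<exists>v \<in> B. perturbed j x v \<and> (\<exists>l \<in> I - {j}. f v l \<noteq> v l)"
proof (rule ccontr)
  assume no: "\<not> ?thesis"
  let ?S = "{v \<in> B. perturbed j x v}"
  have trap: "trap_set V f B" using B by (simp add: attractor_def)
  have "flip v k \<in> ?S" if v: "v \<in> ?S" and k: "k \<in> V" "f v k \<noteq> v k" for v k
  proof -
    have "k \<in> insert j U" using no v k by blast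
    moreover have "perturbed j x v" "v \<in> B" using v by simp_all
    ultimately show ?thesis
      using perturbed_flip[OF x(2) _ j _ k(2)] trap_set_flip[OF trap _ k] by simp
  qed
  then have "trap_set V f ?S"
    using trap unfolding trap_set_def async_arcs_def by blast
  moreover have "x \<in> ?S" using x perturbed_refl by (auto simp: free_stable_def)
  ultimately have "?S = B" using B by (intro attractor_minimal) auto
  then have "perturbed j x y" using y(1) by auto
  from perturbed_fixes[OF this y(2,3)] y(4) show False by simp
qed

section \<open>Assembling the embedding of \<open>H2\<close>\<close>

lemma embedded_H2I:
  assumes I: "I = {a, b}" "a \<noteq> b"
    and "connection a a 1" "connection a a (-1)" "connection b b 1"
    and "connection a b s" "connection a b (-s)" "connection b a t" "connection b a (-t)"
    and "s = 1 \<or> s = -1" "t = 1 \<or> t = -1"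
  shows "embedded H2 G"
proof -
  define \<phi> where "\<phi> = (\<lambda>n::nat. if n = 1 then a else b)"
  have [simp]: "\<phi> (Suc 0) = a" "\<phi> 2 = b" by (simp_all add: \<phi>_def)
  have im: "\<phi> ` vertices H2 = I" by (auto simp: H2_def I)
  have ab: "connection a b 1" "connection a b (-1)" "connection b a 1" "connection b a (-1)"
    using assms(6-11) by auto
  show ?thesis unfolding embedded_def
  proof (intro exI[of _ \<phi>] conjI)
    show "inj_on \<phi> (vertices H2)" using I(2) by (auto simp: H2_def inj_on_def)
    show "\<phi> ` vertices H2 \<subseteq> vertices G" unfolding im by (rule I_subset)
    show "\<forall>(j, i, s) \<in> sarcs H2. if j = i
        then \<exists>p. linking_cycle G (\<phi> ` vertices H2) (\<phi> j) p \<and> walk_sign p = s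
        else \<exists>p. linking_path G (\<phi> ` vertices H2) (\<phi> j) p (\<phi> i) \<and> walk_sign p = s"
      unfolding im using assms(3-5) ab I(2) by (auto simp: H2_def connection_def)
  qed
qed

lemma stable_connection:
  assumes x: "free_stable x" and y: "free_stable y" and j: "j \<in> I" and i: "i \<in> I"
    and eq: "\<And>l. l \<in> I \<Longrightarrow> l \<noteq> j \<Longrightarrow> y l = x l" and neq: "f y i \<noteq> f x i"
  shows "connection j i ((f y i - f x i) * (1 - 2 * x j))"
  using x perturbed_stable[OF x y _ eq] I_subset j i neq
  by (intro perturbed_connection) (auto simp: free_stable_def)

text \<open>On \<open>I\<close>, the points \<open>x\<close> and \<open>y\<close> of
  \<open>B\<close> project to the two neighbours of the corner of \<open>u\<close>, since the
  projections of \<open>A\<close> and \<open>B\<close> are disjoint. The conclusion does not fix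
  which of \<open>a\<close> and \<open>b\<close> gets the negative loop.\<close>

lemma three_corners_embedded:
  assumes I: "I = {a, b}" "a \<noteq> b"
    and A: "attractor V f A" and B: "attractor V f B" and AB: "A \<noteq> B"
    and u: "u \<in> A" and x: "x \<in> B" "x a = u a" and y: "y \<in> B" "y b = u b"
  shows "embedded H2 G"
proof -
  have V: "a \<in> V" "b \<in> V" using I_subset I by auto
  have trap: "trap_set V f A" "trap_set V f B" using A B by (simp_all add: attractor_def)
  obtain u' where u': "u' \<in> A" "free_stable u'" "u' a = u a" "u' b = u b"
    using trap_set_free_stable[OF trap(1) u] I by auto
  obtain x' where x': "x' \<in> B" "free_stable x'" "x' a = u' a"
    using trap_set_free_stable[OF trap(2) x(1)] I x(2) u' by auto
  obtain y' where y': "y' \<in> B" "free_stable y'" "y' b = u' b"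
    using trap_set_free_stable[OF trap(2) y(1)] I y(2) u' by auto
  have conf: "A \<subseteq> configs V" "B \<subseteq> configs V" using trap by (simp_all add: trap_set_def)
  have bin: "z l = 0 \<or> z l = 1" "f z l = 0 \<or> f z l = 1" if "z \<in> A \<union> B" "l \<in> V" for z l
  proof -
    have "z \<in> configs V" using that(1) conf by blast
    then show "z l = 0 \<or> z l = 1" "f z l = 0 \<or> f z l = 1"
      using configs_values[OF _ that(2)] network_configs by simp_all
  qed
  have sep: "\<not> (v a = w a \<and> v b = w b)" if "v \<in> A" "w \<in> B" for v w
    using attractors_differ_on_feedback[OF A B AB that] I by auto
  define \<alpha> \<beta> where "\<alpha> = u' a" and "\<beta> = u' b"
  have ub: "\<alpha> = 0 \<or> \<alpha> = 1" "\<beta> = 0 \<or> \<beta> = 1" using bin(1)[of u' a] bin(1)[of u' b] u'(1) V by (simp_all add: \<alpha>_def \<beta>_def)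
  have xv: "x' a = \<alpha>" "x' b = 1 - \<beta>"
    using x' sep[OF u'(1) x'(1)] bin(1)[of x' b] ub V by (auto simp: \<alpha>_def \<beta>_def)
  have yv: "y' a = 1 - \<alpha>" "y' b = \<beta>"
    using y' sep[OF u'(1) y'(1)] bin(1)[of y' a] ub V by (auto simp: \<alpha>_def \<beta>_def)
  have stay: "f v l = v l" if "v \<in> C" "l \<in> V" "flip v l \<notin> C" "trap_set V f C" for C v l
    using trap_set_flip[OF that(4,1,2)] that(3) by auto
  have flips: "flip v l l = 1 - v l" if "v \<in> A \<union> B" "l \<in> V" for v l
    using flip_same[of v V l] that conf by blast
  have avoid: "\<not> (v a = \<alpha> \<and> v b = \<beta>)" if "v \<in> B" for v
    using sep[OF u'(1) that] by (auto simp: \<alpha>_def \<beta>_def)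
  have fu: "f u' a = \<alpha>" "f u' b = \<beta>"
  proof -
    \<comment> \<open>The flip would reach the corner of \<open>y'\<close>, which belongs to
      \<open>B\<close>; likewise, flipping \<open>b\<close> would reach the corner of
      \<open>x'\<close>.\<close>
    have "flip u' a \<notin> A"
      using sep[OF _ y'(1), of "flip u' a"] flips[of u' a] u' V yv I(2) by (auto simp: \<alpha>_def \<beta>_def)
    then show "f u' a = \<alpha>" using stay[OF u'(1) V(1) _ trap(1)] by (simp add: \<alpha>_def)
    have "flip u' b \<notin> A"
      using sep[OF _ x'(1), of "flip u' b"] flips[of u' b] u' V xv I(2) by (auto simp: \<alpha>_def \<beta>_def)
    then show "f u' b = \<beta>" using stay[OF u'(1) V(2) _ trap(1)] by (simp add: \<beta>_def)
  qed
  \<comment> \<open>Over the corner (\<alpha>, 1 - \<beta>), a flip of \<open>b\<close> would lead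
    \<open>B\<close> to the corner of \<open>A\<close>.\<close>
  have xb: "f v b = 1 - \<beta>" if "v \<in> B" "v a = \<alpha>" for v
  proof -
    have vb: "v b = 1 - \<beta>" using avoid[OF that(1)] that bin(1)[of v b] ub V by auto
    then have "flip v b \<notin> B"
      using avoid[of "flip v b"] flips[of v b] that V I(2) by auto
    then show ?thesis using stay[OF that(1) V(2) _ trap(2)] vb by simp
  qed
  have ya: "f v a = 1 - \<alpha>" if "v \<in> B" "v b = \<beta>" for v
  proof -
    have va: "v a = 1 - \<alpha>" using avoid[OF that(1)] that bin(1)[of v a] ub V by auto
    then have "flip v a \<notin> B"
      using avoid[of "flip v a"] flips[of v a] that V I(2) by auto
    then show ?thesis using stay[OF that(1) V(1) _ trap(2)] va by simp
  qed
  \<comment> \<open>Otherwise \<open>v\<close> is a fixed point and \<open>B\<close> a singleton,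
    but \<open>x'\<close> and \<open>y'\<close> are distinct elements of \<open>B\<close>.\<close>
  have moving: "f v a \<noteq> v a \<or> f v b \<noteq> v b" if v: "v \<in> B" "free_stable v" for v
  proof (rule ccontr)
    assume stuck: "\<not> ?thesis"
    have "f v l = v l" if l: "l \<in> V" for l
    proof (cases "l \<in> I")
      case True
      then have "l = a \<or> l = b" using I(1) by simp
      then show ?thesis using stuck by (elim disjE) simp_all
    next
      case False
      then show ?thesis using v(2) l by (simp add: free_stable_def)
    qed
    then have "B = {v}" by (rule attractor_fixed_point[OF B v(1)])
    then have "x' = v" "y' = v" using x'(1) y'(1) by simp_all
    then have "\<beta> = 1 - \<beta>" using xv yv by simp
    then show False by presburger
  qed
  have xa: "f x' a = 1 - \<alpha>"
    using moving[OF x'(1,2)] xb[OF x'(1)] xv bin(2)[of x' a] x' V ub by auto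
  have yb: "f y' b = 1 - \<beta>"
    using moving[OF y'(1,2)] ya[OF y'(1)] yv bin(2)[of y' b] y' V ub by auto
  \<comment> \<open>The product of the changes at \<open>a\<close> and at \<open>b\<close> on the
    way from (\<alpha>, \<beta>) to the opposite corner; it is the sign found in both directions
    between \<open>a\<close> and \<open>b\<close> when \<open>u'\<close> is compared with
    \<open>y'\<close> and \<open>x'\<close>.\<close>
  define s where "s = (1 - 2 * \<alpha>) * (1 - 2 * \<beta>)"
  have s: "s = 1 \<or> s = -1" using ub by (auto simp: s_def)
  have aa: "connection a a 1"
    using stable_connection[OF u'(2) y'(2), of a a] I ya[OF y'(1)] yv fu ub
    by (auto simp: \<alpha>_def[symmetric] \<beta>_def[symmetric])
  have bb: "connection b b 1"
    using stable_connection[OF u'(2) x'(2), of b b] I xb[OF x'(1)] xv fu ub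
    by (auto simp: \<alpha>_def[symmetric] \<beta>_def[symmetric])
  have ab: "connection a b s"
    using stable_connection[OF u'(2) y'(2), of a b] I yb yv fu ub
    by (auto simp: s_def \<alpha>_def[symmetric] \<beta>_def[symmetric])
  have ba: "connection b a s"
    using stable_connection[OF u'(2) x'(2), of b a] I xa xv fu ub
    by (auto simp: s_def \<alpha>_def[symmetric] \<beta>_def[symmetric])
  \<comment> \<open>From \<open>x'\<close>, only \<open>a\<close> and \<open>U\<close> are updated
    until \<open>b\<close> becomes unstable. By \<open>xb\<close> this happens over the opposite
    corner, and there the image at \<open>b\<close> has changed from 1 - \<beta> to \<beta>, which
    gives the sign \<open>-s\<close>.\<close>
  obtain v where v: "v \<in> B" "perturbed a x' v" "f v b \<noteq> v b"
    using attractor_leaves_perturbed[OF B x'(1,2) V(1) y'(1), of b] I xv yv ub by auto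
  have vb: "v b = 1 - \<beta>"
    using perturbed_fixes[OF v(2), of b] xv I by simp
  have va: "v a = 1 - \<alpha>" using xb[OF v(1)] v(3) vb bin(1)[of v a] v(1) V ub by auto
  have fvb: "f v b = \<beta>" using v vb bin(2)[of v b] V ub by auto
  have xc: "x' \<in> configs V" "y' \<in> configs V" using x' y' by (simp_all add: free_stable_def)
  have ab': "connection a b (-s)"
    using perturbed_connection[OF xc(1) v(2), of b] I fvb xb[OF x'(1)] xv ub
    by (auto simp: s_def)
  obtain v2 where v2: "v2 \<in> B" "perturbed b y' v2" "f v2 a \<noteq> v2 a"
    using attractor_leaves_perturbed[OF B y'(1,2) V(2) x'(1), of a] I xv yv ub by auto
  have v2a: "v2 a = 1 - \<alpha>"
    using perturbed_fixes[OF v2(2), of a] yv I by simp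
  have fv2a: "f v2 a = \<alpha>" using v2 v2a bin(2)[of v2 a] V ub by auto
  have ba': "connection b a (-s)"
    using perturbed_connection[OF xc(2) v2(2), of a] I fv2a ya[OF y'(1)] yv ub
    by (auto simp: s_def)
  \<comment> \<open>A stable configuration over the corner opposite to that of \<open>A\<close>. It
    moves at \<open>a\<close> or at \<open>b\<close>, and comparison with \<open>x'\<close> or
    \<open>y'\<close> respectively gives the negative loop there.\<close>
  obtain w where w: "w \<in> B" "free_stable w" "w a = 1 - \<alpha>" "w b = 1 - \<beta>"
    using trap_set_free_stable[OF trap(2) v(1)] I va vb by auto
  from moving[OF w(1,2)] show ?thesis
  proof
    assume "f w a \<noteq> w a"
    then have "f w a = \<alpha>" using w bin(2)[of w a] V ub by auto
    then have "connection a a (-1)"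
      using stable_connection[OF x'(2) w(2), of a a] I w xa xv ub by auto
    then show ?thesis by (rule embedded_H2I[OF I aa _ bb ab ab' ba ba' s s])
  next
    assume "f w b \<noteq> w b"
    then have "f w b = \<beta>" using w bin(2)[of w b] V ub by auto
    then have "connection b b (-1)"
      using stable_connection[OF y'(2) w(2), of b b] I w yb yv ub by auto
    moreover have "I = {b, a}" "b \<noteq> a" using I by auto
    ultimately show ?thesis using embedded_H2I[of b a, OF _ _ bb _ aa ba ba' ab ab' s s] by simp
  qed
qed

end

theorem theorem46:
  fixes G :: "'v signed_graph"
  assumes "signed_digraph G"
    and "\<not> separating G"
    and "feedback_number G = 2"
  shows "embedded H2 G"
proof -
  obtain I where I: "feedback_vertex_set G I" "card I = 2"
    using feedback_number_witness[OF assms(1)] assms(3) by auto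
  then obtain a b where ab: "I = {a, b}" "a \<noteq> b" by (auto simp: card_2_iff)
  obtain f A B where f: "f \<in> networks_on G"
    and A: "attractor (vertices G) f A" and B: "attractor (vertices G) f B" and AB: "A \<noteq> B"
    and meet: "subspace_hull (vertices G) A \<inter> subspace_hull (vertices G) B \<noteq> {}"
    using assms(2) unfolding separating_def by blast
  interpret feedback_network G f I
    using assms(1) f I(1) by unfold_locales
  have V: "a \<in> V" "b \<in> V" using I_subset ab by auto
  have ne: "A \<noteq> {}" "A \<subseteq> configs V" "B \<noteq> {}" "B \<subseteq> configs V"
    using A B by (auto simp: attractor_def trap_set_def)
  obtain x y where xy: "x \<in> A" "y \<in> B" "x a = y a"
    using hulls_meet_coordinate[OF ne meet V(1)] by blast
  obtain x' y' where xy': "x' \<in> A" "y' \<in> B" "x' b = y' b"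
    using hulls_meet_coordinate[OF ne meet V(2)] by blast
  have "x b = 0 \<or> x b = 1" "y b = 0 \<or> y b = 1" "x' b = 0 \<or> x' b = 1"
    using configs_values[OF _ V(2)] subsetD[OF ne(2)] subsetD[OF ne(4)] xy xy' by simp_all
  moreover have "x b \<noteq> y b"
    using attractors_differ_on_feedback[OF A B AB xy(1,2)] xy(3) ab by auto
  \<comment> \<open>As \<open>x\<close> and \<open>y\<close> take both values at \<open>b\<close>,
    one of them agrees there with \<open>x'\<close> and \<open>y'\<close>. That one supplies the
    isolated corner, and its attractor takes the role of the first attractor.\<close>
  ultimately consider "x b = x' b" | "y b = x' b" by auto
  then show ?thesis
  proof cases
    case 1
    then show ?thesis
      using three_corners_embedded[OF ab A B AB xy(1) xy(2) _ xy'(2)] xy xy' by simp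
  next
    case 2
    then show ?thesis
      using three_corners_embedded[OF ab B A AB[symmetric] xy(2) xy(1) _ xy'(1)] xy xy' by simp
  qed
qed

end
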